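(* Let $A\in\mathbb{R}^{n\times n}$ be an entrywise nonnegative matrix, the adjacency matrix of a network with node set $\mathcal{N}=\{1,\dots,n\}$ and dynamics $x(k+1)=Ax(k)+b(k)u(k)$, $k\in\{0,\dots,K-1\}$. Assume that $A$ is irreducible, aperiodic, and diagonalizable. If $$\arg\max_{i\in\mathcal{N}}R_i(1)\;\cap\;\arg\max_{i\in\mathcal{N}}R_i(\infty)=\emptyset,$$ then the network belongs to class $\mathcal{V}$ for all sufficiently large $K$; that is, there is $\bar K$ such that for all $K>\bar K$, $$\chi=\frac{f^{\mathrm{TV}}_{\max}-f^{\mathrm{TI}}_{\max}}{f^{\mathrm{TI}}_{\max}}>0 .$$
   Context: For a schedule $(\iota_0,\dots,\iota_{K-1})\in\mathcal{N}^K$, $b(k)$ is the $\iota_k$-th column of the $n\times n$ identity matrix, and the controllability Gramian is $\mathcal{W}_K=\sum_{k=0}^{K-1}A^k b(K-1-k)b(K-1-k)^T(A^T)^k$. The controllability measure is $f(\mathcal{W}_K)=\operatorname{tr}(\mathcal{W}_K)$. $f^{\mathrm{TV}}_{\max}$ is the maximum of $f(\mathcal{W}_K)$ over all schedules $(\iota_0,\dots,\iota_{K-1})\in\mathcal{N}^K$ (time-varying control scheduling, TVCS); $f^{\mathrm{TI}}_{\max}$ is the maximum of $f(\mathcal{W}_K)$ over constant schedules $\iota_0=\cdots=\iota_{K-1}$ (time-invariant control scheduling, TICS). A network belongs to class $\mathcal{V}$ if $\chi>0$ and to class $\mathcal{I}$ if $\chi=0$. The $2k$-communicability of node $i$ is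 $R_i(k)=((A^k)^TA^k)_{ii}$, $k\ge0$. $R_i(\infty)$ is defined as $u_i^2$, where $u=(u_1,\dots,u_n)$ is the left Perron–Frobenius eigenvector of $A$ (the left eigenvector centrality; $u^TA=\rho(A)u^T$, $u$ positive, $\rho(A)$ the spectral radius), normalized as $u^Tv=1$ where $v$ is the right Perron–Frobenius eigenvector with $v^Tv=1$. Aperiodic means no integer greater than $1$ divides the length of every cycle of the network. Diagonalizable means diagonalizable over $\mathbb{C}$. *)

theory Defs
  imports
    "HOL-Library.FuncSet"
    "HOL-Combinatorics.Permutations"
    "Jordan_Normal_Form.Spectral_Radius"
    "Graph_Theory.Pair_Digraph"
begin

text \<open>
  Matrices and vectors are those of \<open>Jordan_Normal_Form\<close>, so indices start at \<open>0\<close>: the nodes of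
  a network with \<open>n \<times> n\<close> adjacency matrix \<open>A\<close> are \<open>0, \<dots>, n - 1\<close>.
  The matrix \<open>A\<close> is assumed to be square throughout.
\<close>

definition nodes :: "real mat \<Rightarrow> nat set" where
  "nodes A = {..<dim_row A}"

text \<open>In \<open>x(k+1) = A x(k)\<close> the entry \<open>A $$ (i, j)\<close> is the weight of the edge from \<open>j\<close> to \<open>i\<close>.\<close>

definition network :: "real mat \<Rightarrow> nat pair_pre_digraph" where
  "network A = \<lparr> pverts = nodes A,
     parcs = {(j, i). j \<in> nodes A \<and> i \<in> nodes A \<and> A $$ (i, j) \<noteq> 0} \<rparr>"

definition nonneg_mat :: "real mat \<Rightarrow> bool" where
  "nonneg_mat A \<longleftrightarrow> (\<forall>i < dim_row A. \<forall>j < dim_col A. 0 \<le> A $$ (i, j))"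

text \<open>
  Reducible: some simultaneous permutation of rows and columns makes \<open>A\<close> block upper triangular
  with two nonempty square diagonal blocks, the first of size \<open>r\<close>.
\<close>

definition reducible_mat :: "real mat \<Rightarrow> bool" where
  "reducible_mat A \<longleftrightarrow>
     (\<exists>p r. p permutes {..<dim_row A} \<and> 0 < r \<and> r < dim_row A \<and>
        (\<forall>i \<in> {r..<dim_row A}. \<forall>j < r. A $$ (p i, p j) = 0))"

definition irreducible_mat :: "real mat \<Rightarrow> bool" where
  "irreducible_mat A \<longleftrightarrow> \<not> reducible_mat A"

text \<open>A cycle in the sense of \<^const>\<open>pre_digraph.cycle\<close> may be a loop, of length \<open>1\<close>.\<close>

definition aperiodic_mat :: "real mat \<Rightarrow> bool" where
  "aperiodic_mat A \<longleftrightarrow>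
     \<not> (\<exists>d::nat. d > 1 \<and>
          (\<forall>c. pre_digraph.cycle (with_proj (network A)) c \<longrightarrow> d dvd length c))"

abbreviation complexify :: "real mat \<Rightarrow> complex mat" where
  "complexify A \<equiv> map_mat complex_of_real A"

definition diagonalizable_mat :: "real mat \<Rightarrow> bool" where
  "diagonalizable_mat A \<longleftrightarrow> (\<exists>D. diagonal_mat D \<and> similar_mat (complexify A) D)"

definition pos_vec :: "real vec \<Rightarrow> bool" where
  "pos_vec v \<longleftrightarrow> (\<forall>i < dim_vec v. 0 < v $ i)"

text \<open>
  For irreducible nonnegative \<open>A\<close>, the Perron-Frobenius theorem gives existence and uniqueness of
  the vectors described in the next two definitions.
\<close>

definition right_pf :: "real mat \<Rightarrow> real vec" where
  "right_pf A = (THE v. v \<in> carrier_vec (dim_row A) \<and> pos_vec v \<and>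
     A *\<^sub>v v = spectral_radius (complexify A) \<cdot>\<^sub>v v \<and> v \<bullet> v = 1)"

definition left_pf :: "real mat \<Rightarrow> real vec" where
  "left_pf A = (THE u. u \<in> carrier_vec (dim_row A) \<and> pos_vec u \<and>
     transpose_mat A *\<^sub>v u = spectral_radius (complexify A) \<cdot>\<^sub>v u \<and> u \<bullet> right_pf A = 1)"

text \<open>The \<open>2k\<close>-communicability \<open>R\<^sub>i(k)\<close> of node \<open>i\<close>, and \<open>R\<^sub>i(\<infinity>)\<close>.\<close>

definition communicability :: "real mat \<Rightarrow> nat \<Rightarrow> nat \<Rightarrow> real" where
  "communicability A k i = (transpose_mat (A ^\<^sub>m k) * (A ^\<^sub>m k)) $$ (i, i)"

definition communicability_inf :: "real mat \<Rightarrow> nat \<Rightarrow> real" where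
  "communicability_inf A i = (left_pf A $ i)\<^sup>2"

definition argmax_nodes :: "real mat \<Rightarrow> (nat \<Rightarrow> real) \<Rightarrow> nat set" where
  "argmax_nodes A R = {i. is_arg_max R (\<lambda>j. j \<in> nodes A) i}"

text \<open>The \<open>j\<close>-th column of the \<open>n \<times> n\<close> identity matrix, as an \<open>n \<times> 1\<close> matrix.\<close>

definition input_col :: "nat \<Rightarrow> nat \<Rightarrow> real mat" where
  "input_col n j = mat_of_cols n [col (1\<^sub>m n) j]"

text \<open>The matrix sum over \<open>k < K\<close> is taken entrywise.\<close>

definition gramian :: "real mat \<Rightarrow> nat \<Rightarrow> (nat \<Rightarrow> nat) \<Rightarrow> real mat" where
  "gramian A K \<iota> =
     (let n = dim_row A; b = (\<lambda>k. input_col n (\<iota> k)) in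
      mat n n (\<lambda>ij. \<Sum>k<K.
        (A ^\<^sub>m k * b (K - 1 - k) * transpose_mat (b (K - 1 - k)) * (transpose_mat A) ^\<^sub>m k) $$ ij))"

definition mat_trace :: "real mat \<Rightarrow> real" where
  "mat_trace M = (\<Sum>i < dim_row M. M $$ (i, i))"

definition schedules :: "real mat \<Rightarrow> nat \<Rightarrow> (nat \<Rightarrow> nat) set" where
  "schedules A K = {..<K} \<rightarrow>\<^sub>E nodes A"

definition constant_schedules :: "real mat \<Rightarrow> nat \<Rightarrow> (nat \<Rightarrow> nat) set" where
  "constant_schedules A K = {\<iota> \<in> schedules A K. \<exists>i \<in> nodes A. \<forall>k<K. \<iota> k = i}"

definition f_max_TV :: "real mat \<Rightarrow> nat \<Rightarrow> real" where
  "f_max_TV A K = Max ((\<lambda>\<iota>. mat_trace (gramian A K \<iota>)) ` schedules A K)"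

definition f_max_TI :: "real mat \<Rightarrow> nat \<Rightarrow> real" where
  "f_max_TI A K = Max ((\<lambda>\<iota>. mat_trace (gramian A K \<iota>)) ` constant_schedules A K)"

definition chi :: "real mat \<Rightarrow> nat \<Rightarrow> real" where
  "chi A K = (f_max_TV A K - f_max_TI A K) / f_max_TI A K"

definition class_V :: "real mat \<Rightarrow> nat \<Rightarrow> bool" where
  "class_V A K \<longleftrightarrow> chi A K > 0"

end

theory Submission
  imports Defs
begin

text \<open>
  With \<open>R\<^sub>i(k)\<close> the communicability of node \<open>i\<close>, the trace of the Gramian of a schedule \<open>\<iota>\<close> is the
  sum of \<open>R\<^bsub>\<iota>(K-1-k)\<^esub>(k)\<close> over \<open>k < K\<close>. In this sum the nodes for different \<open>k\<close> can be chosen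
  independently, so a constant schedule \<open>i\<close> fails to be optimal as soon as \<open>i\<close> is beaten by some
  other node at a single \<open>k < K\<close> (\<open>class_V_if_no_constant_optimum\<close>). It is therefore enough that
  every node \<open>i\<close> is beaten at some \<open>k\<close>; since there are finitely many nodes, all these \<open>k\<close> lie
  below a common bound.

  A node outside the arg max of \<open>R(1)\<close> is beaten at \<open>k = 1\<close>. A node in it lies, by hypothesis,
  outside the arg max of \<open>R(\<infinity>)\<close>, so \<open>R\<^sub>i(\<infinity>) < R\<^sub>j(\<infinity>)\<close> for some \<open>j\<close>. Along a sequence of \<open>k\<close> tending
  to infinity, \<open>R\<^sub>i(k) / \<rho>\<^bsup>2k\<^esup>\<close> tends to \<open>R\<^sub>i(\<infinity>)\<close> for every node \<open>i\<close>, where \<open>\<rho>\<close> is the spectral radius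
  (\<open>communicability_tendsto\<close>); hence \<open>j\<close> beats \<open>i\<close> at some such \<open>k\<close>.

  The limit is the Perron-Frobenius theorem for primitive matrices. Irreducibility and aperiodicity
  make some power \<open>A\<^sup>m\<close> entrywise positive (\<open>irreducible_aperiodic_imp_primitive\<close>). The entrywise
  modulus of an eigenvector for an eigenvalue of maximal modulus, multiplied by \<open>A\<^sup>m\<close>, is a positive
  eigenvector for \<open>\<rho>\<close> (\<open>perron_vector_exists\<close>). Given positive right and left eigenvectors \<open>v\<close>
  and \<open>u\<close> with \<open>u \<bullet> v = 1\<close>, the matrix \<open>(A\<^sup>m / \<rho>\<^sup>m)\<^sup>k\<close> converges to \<open>v u\<^sup>T\<close>, because \<open>A\<^sup>m / \<rho>\<^sup>m\<close>
  dominates a positive multiple of \<open>v u\<^sup>T\<close> and is therefore a contraction on the vectors orthogonal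
  to \<open>u\<close> (\<open>rank_one_contraction\<close>). Since the limit does not depend on the chosen pair, this also
  gives the uniqueness of the normalised eigenvectors (\<open>pf_vectors\<close>).
\<close>

section \<open>Numerical semigroups\<close>

text \<open>
  Let \<open>d\<close> be the least positive difference of two elements. Division with remainder of any element
  by \<open>d\<close> would produce a smaller difference unless \<open>d\<close> divides it, so \<open>d = 1\<close> and there are \<open>a\<close> and
  \<open>a + 1\<close> in \<open>S\<close>. Every number from \<open>a\<^sup>2\<close> on is a sum of copies of these two.
\<close>

lemma additive_semigroup_cofinite:
  fixes S :: "nat set"
  assumes zero: "0 \<in> S" and add: "\<And>a b. a \<in> S \<Longrightarrow> b \<in> S \<Longrightarrow> a + b \<in> S" and gcd: "Gcd S = 1"
  shows "\<exists>N. \<forall>k\<ge>N. k \<in> S"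
proof -
  have mult: "q * a \<in> S" if "a \<in> S" for q a
    by (induction q) (use that zero add in auto)
  define gap where "gap d \<longleftrightarrow> d > 0 \<and> (\<exists>a\<in>S. a + d \<in> S)" for d
  have "\<exists>x\<in>S. x > 0"
  proof (rule ccontr)
    assume "\<not> ?thesis"
    then have "S = {0}" using zero by auto
    with gcd show False by simp
  qed
  then obtain x0 where "x0 \<in> S" "x0 > 0" by blast
  then have ex: "gap x0" unfolding gap_def using zero by (metis add_0)
  define d where "d = (LEAST d. gap d)"
  have gd: "gap d" unfolding d_def by (rule LeastI[of gap, OF ex])
  then obtain a where a: "a \<in> S" "a + d \<in> S" and d0: "d > 0" unfolding gap_def by blast
  have "d dvd x" if x: "x \<in> S" for x
  proof (rule ccontr)
    assume nd: "\<not> d dvd x"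
    define q r where "q = x div d" and "r = x mod d"
    have r: "0 < r" "r < d" using nd d0 unfolding r_def by (auto simp: dvd_eq_mod_eq_0)
    have eq: "q * a + x = q * (a + d) + r"
      unfolding q_def r_def by (simp add: algebra_simps)
    have "q * (a + d) \<in> S" "q * a + x \<in> S" using mult add a x by auto
    then have "gap r" unfolding gap_def using r eq by auto
    then have "d \<le> r" unfolding d_def by (rule Least_le)
    with r show False by simp
  qed
  then have "d dvd Gcd S" by (simp add: Gcd_greatest)
  with gcd have d1: "d = 1" by simp
  show ?thesis
  proof (cases "a = 0")
    case True
    then have "1 \<in> S" using a d1 by simp
    then have "\<forall>k. k \<in> S" using mult by (metis mult.right_neutral)
    then show ?thesis by blast
  next
    case False
    have "k \<in> S" if k: "k \<ge> a * a" for k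
    proof -
      define q r where "q = k div a" and "r = k mod a"
      have "r < a" using False r_def by simp
      moreover have "a \<le> q" unfolding q_def using k False by (simp add: less_eq_div_iff_mult_less_eq)
      ultimately have "r \<le> q" by simp
      have "k = q * a + r" unfolding q_def r_def by simp
      also have "\<dots> = (q - r) * a + r * (a + 1)"
        using \<open>r \<le> q\<close> by (simp add: algebra_simps flip: add_mult_distrib)
      also have "\<dots> \<in> S" using mult add a d1 by blast
      finally show ?thesis .
    qed
    then show ?thesis by blast
  qed
qed

section \<open>Powers of nonnegative matrices and walks\<close>

lemma pow_mat_add:
  fixes A :: "'a :: semiring_1 mat"
  assumes "A \<in> carrier_mat n n"
  shows "A ^\<^sub>m (k + l) = A ^\<^sub>m k * A ^\<^sub>m l"
proof (induction l)
  case 0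
  then show ?case using assms pow_carrier_mat[OF assms, of k] by simp
next
  case (Suc l)
  then show ?case
    using assoc_mult_mat[OF pow_carrier_mat[OF assms, of k] pow_carrier_mat[OF assms, of l] assms]
    by simp
qed

lemma transpose_pow_mat:
  fixes A :: "'a :: comm_semiring_1 mat"
  assumes "A \<in> carrier_mat n n"
  shows "transpose_mat A ^\<^sub>m k = transpose_mat (A ^\<^sub>m k)"
proof (induction k)
  case 0
  then show ?case using assms by simp
next
  case (Suc k)
  have "A ^\<^sub>m Suc k = A * A ^\<^sub>m k"
    using pow_mat_add[OF assms, of 1 k] assms by simp
  then show ?case
    using Suc transpose_mult[OF assms pow_carrier_mat[OF assms, of k]] by simp
qed

lemma mult_mat_entry:
  assumes "B \<in> carrier_mat n n" "C \<in> carrier_mat n n" "i < n" "j < n"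
  shows "(B * C) $$ (i, j) = (\<Sum>l<n. B $$ (i, l) * C $$ (l, j))"
  using assms by (simp add: scalar_prod_def lessThan_atLeast0)

lemma mult_mat_vec_entry:
  assumes "B \<in> carrier_mat n n" "z \<in> carrier_vec n" "i < n"
  shows "(B *\<^sub>v z) $ i = (\<Sum>l<n. B $$ (i, l) * z $ l)"
  using assms by (simp add: scalar_prod_def lessThan_atLeast0)

lemma nonneg_mult_mat:
  assumes "B \<in> carrier_mat n n" "C \<in> carrier_mat n n" "nonneg_mat B" "nonneg_mat C"
  shows "nonneg_mat (B * C)"
  using assms unfolding nonneg_mat_def
  by (auto simp: mult_mat_entry simp del: index_mult_mat(1) intro!: sum_nonneg)

lemma nonneg_pow_mat:
  assumes "A \<in> carrier_mat n n" "nonneg_mat A"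
  shows "nonneg_mat (A ^\<^sub>m k)"
proof (induction k)
  case 0
  then show ?case using assms by (auto simp: nonneg_mat_def)
next
  case (Suc k)
  then show ?case using assms nonneg_mult_mat[OF pow_carrier_mat[OF assms(1)] assms(1)] by simp
qed

lemma pow_mat_pos_trans:
  assumes A: "A \<in> carrier_mat n n" "nonneg_mat A" and ijl: "i < n" "j < n" "l < n"
    and pos: "0 < (A ^\<^sub>m a) $$ (i, l)" "0 < (A ^\<^sub>m b) $$ (l, j)"
  shows "0 < (A ^\<^sub>m (a + b)) $$ (i, j)"
proof -
  have c: "A ^\<^sub>m k \<in> carrier_mat n n" for k using A by simp
  have nn: "0 \<le> (A ^\<^sub>m k) $$ (x, y)" if "x < n" "y < n" for k x y
    using nonneg_pow_mat[OF A, of k] that A unfolding nonneg_mat_def by simp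
  have "(A ^\<^sub>m (a + b)) $$ (i, j) = (\<Sum>l<n. (A ^\<^sub>m a) $$ (i, l) * (A ^\<^sub>m b) $$ (l, j))"
    unfolding pow_mat_add[OF A(1)] using mult_mat_entry[OF c c] ijl by blast
  moreover have "0 < \<dots>"
    by (rule sum_pos2[of _ l]) (use ijl pos nn in auto)
  ultimately show ?thesis by simp
qed

text \<open>
  If the set \<open>S\<close> of nodes reachable from \<open>j\<close> were
  proper, no edge would leave it, and listing \<open>S\<close> before its complement would give the block
  triangular form that irreducibility excludes.
\<close>

lemma irreducible_imp_connected:
  assumes A: "A \<in> carrier_mat n n" "nonneg_mat A" "irreducible_mat A"
    and ij: "i < n" "j < n"
  shows "\<exists>k. 0 < (A ^\<^sub>m k) $$ (i, j)"
proof -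
  define S where "S = {i. i < n \<and> (\<exists>k. 0 < (A ^\<^sub>m k) $$ (i, j))}"
  have jS: "j \<in> S" unfolding S_def using ij A by (auto intro!: exI[of _ 0])
  have fin: "finite S" and sub: "S \<subseteq> {..<n}" unfolding S_def by auto
  have zero: "A $$ (t, s) = 0" if "s \<in> S" "t < n" "t \<notin> S" for s t
  proof (rule ccontr)
    assume "A $$ (t, s) \<noteq> 0"
    moreover have "0 \<le> A $$ (t, s)" using A that unfolding nonneg_mat_def S_def by auto
    ultimately have "0 < (A ^\<^sub>m 1) $$ (t, s)" using A by simp
    moreover obtain k where "0 < (A ^\<^sub>m k) $$ (s, j)" using \<open>s \<in> S\<close> unfolding S_def by blast
    ultimately have "0 < (A ^\<^sub>m (1 + k)) $$ (t, j)"
      using pow_mat_pos_trans[OF A(1,2)] that ij unfolding S_def by blast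
    then show False using that unfolding S_def by blast
  qed
  have "S = {..<n}"
  proof (rule ccontr)
    assume ne: "S \<noteq> {..<n}"
    define r where "r = card S"
    have r: "0 < r" "r < n"
      unfolding r_def using jS fin psubset_card_mono[of "{..<n}" S] ne sub
      by (auto simp: card_gt_0_iff)
    obtain f where f: "bij_betw f {..<r} S"
      using finite_same_card_bij[of "{..<r}" S] fin r_def by auto
    have "card {r..<n} = card ({..<n} - S)"
      using card_Diff_subset[OF fin sub] r_def by simp
    then obtain g where g: "bij_betw g {r..<n} ({..<n} - S)"
      using finite_same_card_bij[of "{r..<n}" "{..<n} - S"] by auto
    define p where "p x = (if x < r then f x else if x < n then g x else x)" for x
    have pf: "bij_betw p {..<r} S" using f by (rule bij_betw_cong[THEN iffD1, rotated]) (auto simp: p_def)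
    have pg: "bij_betw p {r..<n} ({..<n} - S)"
      using g by (rule bij_betw_cong[THEN iffD1, rotated]) (auto simp: p_def)
    have "bij_betw p ({..<r} \<union> {r..<n}) (S \<union> ({..<n} - S))"
      by (rule bij_betw_combine[OF pf pg]) auto
    moreover have "{..<r} \<union> {r..<n} = {..<n}" "S \<union> ({..<n} - S) = {..<n}" using r sub by auto
    ultimately have "p permutes {..<n}"
      by (intro bij_imp_permutes) (use r in \<open>auto simp: p_def\<close>)
    moreover have "A $$ (p i, p j) = 0" if "i \<in> {r..<n}" "j < r" for i j
      using zero bij_betwE[OF pf] bij_betwE[OF pg] that by auto
    ultimately have "reducible_mat A"
      unfolding reducible_mat_def using A r by (auto intro!: exI[of _ p] exI[of _ r])
    with A show False unfolding irreducible_mat_def by simp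
  qed
  then show ?thesis using ij S_def by auto
qed

lemma walk_imp_pow_mat_pos:
  assumes A: "A \<in> carrier_mat n n" "nonneg_mat A"
    and w: "set p \<subseteq> arcs (with_proj (network A))" "pre_digraph.cas (with_proj (network A)) u p v"
    and u: "u < n"
  shows "v < n \<and> 0 < (A ^\<^sub>m length p) $$ (v, u)"
  using w u
proof (induction p arbitrary: u)
  case Nil
  then show ?case using A by (auto simp: pre_digraph.cas.simps)
next
  case (Cons e p)
  obtain h where e: "e = (u, h)" and h: "h < n" and ne: "A $$ (h, u) \<noteq> 0"
    and rest: "pre_digraph.cas (with_proj (network A)) h p v"
    using Cons.prems A by (auto simp: pre_digraph.cas.simps network_def nodes_def)
  have IH: "v < n" "0 < (A ^\<^sub>m length p) $$ (v, h)" using Cons.IH[OF _ rest h] Cons.prems by auto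
  have "0 < (A ^\<^sub>m 1) $$ (h, u)"
    using ne A h Cons.prems(3) unfolding nonneg_mat_def by (simp add: less_le)
  from pow_mat_pos_trans[OF A IH(1) Cons.prems(3) h IH(2) this] show ?case using IH by simp
qed

definition primitive_mat :: "real mat \<Rightarrow> bool" where
  "primitive_mat A \<longleftrightarrow> (\<exists>m>0. \<forall>i<dim_row A. \<forall>j<dim_row A. 0 < (A ^\<^sub>m m) $$ (i, j))"

text \<open>
  The lengths of the closed walks at node \<open>0\<close> form an additive semigroup. A cycle can be inserted
  into a closed walk that passes through one of its nodes, so the greatest common divisor of the
  semigroup divides the length of every cycle and is \<open>1\<close> by aperiodicity. Hence there are closed
  walks at \<open>0\<close> of every large length, and they pad walks \<open>j \<rightarrow> 0 \<rightarrow> i\<close> to a common length.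
\<close>

lemma irreducible_aperiodic_imp_primitive:
  assumes A: "A \<in> carrier_mat n n" "nonneg_mat A" "irreducible_mat A" "aperiodic_mat A"
  shows "primitive_mat A"
proof (cases "n = 0")
  case True
  then show ?thesis using A(1) unfolding primitive_mat_def by auto
next
  case False
  then have n: "0 < n" by simp
  note trans = pow_mat_pos_trans[OF A(1,2)]
  define S where "S = {k. 0 < (A ^\<^sub>m k) $$ (0, 0)}"
  have zero: "0 \<in> S" unfolding S_def using A n by simp
  have add: "a + b \<in> S" if "a \<in> S" "b \<in> S" for a b
    using that trans[OF n n n] unfolding S_def by blast
  have cyc: "Gcd S dvd length c" if c: "pre_digraph.cycle (with_proj (network A)) c" for c
  proof -
    obtain i where "pre_digraph.awalk (with_proj (network A)) i c i"
      using c unfolding pre_digraph.cycle_def by blast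
    then have i: "i < n" "set c \<subseteq> arcs (with_proj (network A))"
        "pre_digraph.cas (with_proj (network A)) i c i"
      using A unfolding pre_digraph.awalk_def by (auto simp: network_def nodes_def)
    have pos: "0 < (A ^\<^sub>m length c) $$ (i, i)" using walk_imp_pow_mat_pos[OF A(1,2) i(2,3,1)] by simp
    obtain a b where ab: "0 < (A ^\<^sub>m a) $$ (0, i)" "0 < (A ^\<^sub>m b) $$ (i, 0)"
      using irreducible_imp_connected[OF A(1-3)] n i by meson
    have "a + b \<in> S" unfolding S_def using trans[OF n n i(1) ab] by simp
    moreover have "a + length c + b \<in> S"
      unfolding S_def using trans[OF n n i(1) trans[OF n i(1) i(1) ab(1) pos] ab(2)] by simp
    ultimately have "Gcd S dvd a + b" "Gcd S dvd a + b + length c"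
      by (auto simp: add.assoc add.commute[of "length c"])
    then show ?thesis using dvd_add_right_iff by blast
  qed
  have "Gcd S = 1"
  proof (rule ccontr)
    assume "Gcd S \<noteq> 1"
    \<comment> \<open>A greatest common divisor of \<open>0\<close> forces every cycle to have length \<open>0\<close>, which \<open>2\<close> divides.\<close>
    then have "\<exists>d>1. \<forall>c. pre_digraph.cycle (with_proj (network A)) c \<longrightarrow> d dvd length c"
      using cyc by (cases "Gcd S = 0") (fastforce intro: exI[of _ 2] exI[of _ "Gcd S"])+
    then show False using A unfolding aperiodic_mat_def by blast
  qed
  then obtain N where N: "\<And>k. k \<ge> N \<Longrightarrow> k \<in> S"
    using additive_semigroup_cofinite[OF zero add] by blast
  have "\<forall>i. \<exists>k. i < n \<longrightarrow> 0 < (A ^\<^sub>m k) $$ (i, 0)" "\<forall>j. \<exists>k. j < n \<longrightarrow> 0 < (A ^\<^sub>m k) $$ (0, j)"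
    using irreducible_imp_connected[OF A(1-3)] n by blast+
  then obtain a b where a: "\<And>i. i < n \<Longrightarrow> 0 < (A ^\<^sub>m a i) $$ (i, 0)"
    and b: "\<And>j. j < n \<Longrightarrow> 0 < (A ^\<^sub>m b j) $$ (0, j)"
    unfolding choice_iff by blast
  \<comment> \<open>Large enough to leave a middle part of length at least \<open>N\<close> for all \<open>i\<close>, \<open>j\<close>; \<open>Suc\<close> makes \<open>m\<close> positive.\<close>
  define m where "m = Suc N + sum a {..<n} + sum b {..<n}"
  have "0 < (A ^\<^sub>m m) $$ (i, j)" if ij: "i < n" "j < n" for i j
  proof -
    have le: "a i \<le> sum a {..<n}" "b j \<le> sum b {..<n}" using ij by (auto intro: member_le_sum)
    define s where "s = m - a i - b j"
    have s: "s \<ge> N" "a i + s + b j = m" unfolding s_def m_def using le by auto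
    have "0 < (A ^\<^sub>m s) $$ (0, 0)" using N[OF s(1)] S_def by simp
    from trans[OF ij n trans[OF ij(1) n n a[OF ij(1)] this] b[OF ij(2)]]
    show ?thesis using s by simp
  qed
  moreover have "m > 0" unfolding m_def by simp
  ultimately show ?thesis unfolding primitive_mat_def using A(1) by auto
qed

section \<open>Positive eigenvectors for the spectral radius\<close>

text \<open>
  For nonnegative \<open>t\<close>, a nonnegative nonzero vector with \<open>A z \<ge> t z\<close> has \<open>A\<^sup>k z \<ge> t\<^sup>k z\<close>, so \<open>A\<^sup>k\<close> grows at least like
  \<open>t\<^sup>k\<close>. If \<open>t\<close> exceeded the spectral radius, then for \<open>s\<close> strictly between the two the powers of
  \<open>A / s\<close> would be bounded, yet grow like \<open>(t / s)\<^sup>k\<close>.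
\<close>

lemma collatz_wielandt_le_spectral_radius:
  assumes A: "A \<in> carrier_mat n n" "nonneg_mat A"
    and z: "z \<in> carrier_vec n" "\<And>i. i < n \<Longrightarrow> 0 \<le> z $ i"
    and i0: "i0 < n" "0 < z $ i0"
    and le: "\<And>i. i < n \<Longrightarrow> t * z $ i \<le> (A *\<^sub>v z) $ i"
  shows "t \<le> spectral_radius (complexify A)"
proof (rule ccontr)
  define \<rho> where "\<rho> = spectral_radius (complexify A)"
  assume "\<not> t \<le> spectral_radius (complexify A)"
  then have t: "\<rho> < t" unfolding \<rho>_def by simp
  have n: "0 < n" using i0 by simp
  have cA: "complexify A \<in> carrier_mat n n" using A by simp
  have \<rho>0: "0 \<le> \<rho>" using spectral_radius_mem_max(1)[OF cA n] unfolding \<rho>_def by auto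
  define s where "s = (\<rho> + t) / 2"
  have s: "0 < s" "\<rho> < s" "s < t" using \<rho>0 t unfolding s_def by auto
  define B where "B = (1 / s) \<cdot>\<^sub>m A"
  have B: "B \<in> carrier_mat n n" using A unfolding B_def by simp
  have Bk: "B ^\<^sub>m k \<in> carrier_mat n n" for k using B by simp
  have nonB: "nonneg_mat B" using A s unfolding B_def nonneg_mat_def by simp
  have cB: "complexify B \<in> carrier_mat n n" using B by simp
  have cBA: "complexify A = complex_of_real s \<cdot>\<^sub>m complexify B"
    using s A unfolding B_def by (intro eq_matI) auto
  have "spectral_radius (complexify B) < 1"
  proof -
    obtain l where l: "l \<in> spectrum (complexify B)" "spectral_radius (complexify B) = norm l"
      using spectral_radius_mem_max(1)[OF cB n] by auto
    then obtain x where x: "eigenvector (complexify B) x l"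
      unfolding spectrum_def eigenvalue_def by auto
    then have xc: "x \<in> carrier_vec n" "x \<noteq> 0\<^sub>v n" "complexify B *\<^sub>v x = l \<cdot>\<^sub>v x"
      using B unfolding eigenvector_def by auto
    have "complexify A *\<^sub>v x = (complex_of_real s * l) \<cdot>\<^sub>v x"
    proof -
      have "complexify A *\<^sub>v x = complex_of_real s \<cdot>\<^sub>v (complexify B *\<^sub>v x)"
        unfolding cBA using cB xc(1)
        by (intro eq_vecI) (auto simp: scalar_prod_def sum_distrib_left mult.assoc)
      then show ?thesis unfolding xc(3) by (simp add: smult_smult_assoc)
    qed
    then have "complex_of_real s * l \<in> spectrum (complexify A)"
      unfolding spectrum_def eigenvalue_def eigenvector_def using xc A by auto
    then have "norm (complex_of_real s * l) \<le> \<rho>"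
      unfolding \<rho>_def by (intro spectral_radius_mem_max(2)[OF cA n]) auto
    then have "s * norm l \<le> \<rho>" using s by (simp add: norm_mult)
    then have "s * norm l < s * 1" using s by linarith
    then have "norm l < 1" using s by (simp only: mult_less_cancel_left_pos)
    then show ?thesis using l by simp
  qed
  then obtain c where c: "\<And>k. norm_bound (complexify B ^\<^sub>m k) c"
    using spectral_radius_jnf_norm_bound_less_1_upper_triangular[OF cB] by blast
  have bound: "(B ^\<^sub>m k) $$ (i, j) \<le> c" if "i < n" "j < n" for k i j
  proof -
    have "complexify B ^\<^sub>m k = complexify (B ^\<^sub>m k)"
      by (rule of_real_hom.mat_hom_pow[OF B, symmetric])
    then have "norm (complex_of_real ((B ^\<^sub>m k) $$ (i, j))) \<le> c"
      using c[of k] that B Bk[of k] unfolding norm_bound_def by auto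
    then show ?thesis by simp
  qed
  define q where "q = t / s"
  have q: "1 < q" unfolding q_def using s by simp
  have grow: "q ^ k * z $ i \<le> (B ^\<^sub>m k *\<^sub>v z) $ i" if "i < n" for k i
    using that
  proof (induction k arbitrary: i)
    case 0
    then show ?case using B z by simp
  next
    case (Suc k)
    have "q ^ Suc k * z $ i = q ^ k * (t * z $ i / s)" unfolding q_def by simp
    also have "\<dots> \<le> q ^ k * ((A *\<^sub>v z) $ i / s)"
      using le[OF Suc.prems] s q by (intro mult_left_mono divide_right_mono) auto
    also have "\<dots> = (\<Sum>l<n. B $$ (i, l) * (q ^ k * z $ l))"
      unfolding mult_mat_vec_entry[OF A(1) z(1) Suc.prems] sum_distrib_left sum_divide_distrib
      using A Suc.prems by (intro sum.cong) (auto simp: B_def)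
    also have "\<dots> \<le> (\<Sum>l<n. B $$ (i, l) * (B ^\<^sub>m k *\<^sub>v z) $ l)"
      using Suc nonB B unfolding nonneg_mat_def by (intro sum_mono mult_left_mono) auto
    also have "\<dots> = (B *\<^sub>v (B ^\<^sub>m k *\<^sub>v z)) $ i"
      using mult_mat_vec_entry[OF B _ Suc.prems] Bk[of k] z by (metis mult_mat_vec_carrier)
    also have "B *\<^sub>v (B ^\<^sub>m k *\<^sub>v z) = B ^\<^sub>m Suc k *\<^sub>v z"
      using pow_mat_add[OF B, of 1 k] assoc_mult_mat_vec[OF B Bk[of k] z(1)] B by simp
    finally show ?case .
  qed
  define C where "C = (\<Sum>l<n. c * z $ l)"
  obtain k where k: "C / z $ i0 < q ^ k" using real_arch_pow[OF q] by blast
  have "q ^ k * z $ i0 \<le> (\<Sum>l<n. (B ^\<^sub>m k) $$ (i0, l) * z $ l)"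
    using grow[OF i0(1), of k] mult_mat_vec_entry[OF Bk[of k] z(1) i0(1)] by simp
  also have "\<dots> \<le> C" unfolding C_def
    using bound i0 z by (intro sum_mono mult_right_mono) auto
  finally show False using k i0 by (simp add: field_simps)
qed

lemma positive_mult_vec:
  fixes B :: "real mat"
  assumes B: "B \<in> carrier_mat n n" "\<And>i j. i < n \<Longrightarrow> j < n \<Longrightarrow> 0 < B $$ (i, j)"
    and z: "z \<in> carrier_vec n" "\<And>i. i < n \<Longrightarrow> 0 \<le> z $ i" "i0 < n" "0 < z $ i0"
    and i: "i < n"
  shows "0 < (B *\<^sub>v z) $ i"
  unfolding mult_mat_vec_entry[OF B(1) z(1) i]
  using assms by (intro sum_pos2[of _ i0]) (auto intro!: mult_nonneg_nonneg simp: less_imp_le)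

text \<open>
  Let \<open>A x = l x\<close> with \<open>\<bar>l\<bar> = \<rho>\<close>, and let \<open>y\<close> be the entrywise modulus of \<open>x\<close>. The triangle
  inequality gives \<open>A y \<ge> \<rho> y\<close>. If \<open>g = A y - \<rho> y\<close> were nonzero, then for the positive vector
  \<open>v = A\<^sup>m y\<close> the difference \<open>A v - \<rho> v = A\<^sup>m g\<close> would be positive, so \<open>A v \<ge> t v\<close> for some
  \<open>t > \<rho>\<close>, against the preceding bound. So \<open>A y = \<rho> y\<close>, and \<open>v\<close> is the required eigenvector.
\<close>

lemma perron_vector_exists:
  assumes A: "A \<in> carrier_mat n n" "nonneg_mat A" and n: "0 < n"
    and m: "\<And>i j. i < n \<Longrightarrow> j < n \<Longrightarrow> 0 < (A ^\<^sub>m m) $$ (i, j)"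
  shows "\<exists>v \<in> carrier_vec n. pos_vec v \<and> A *\<^sub>v v = spectral_radius (complexify A) \<cdot>\<^sub>v v"
proof -
  define \<rho> where "\<rho> = spectral_radius (complexify A)"
  have cA: "complexify A \<in> carrier_mat n n" using A by simp
  have Am: "A ^\<^sub>m m \<in> carrier_mat n n" using A by simp
  obtain l where l: "l \<in> spectrum (complexify A)" "\<rho> = norm l"
    using spectral_radius_mem_max(1)[OF cA n] unfolding \<rho>_def by auto
  then obtain x where x: "x \<in> carrier_vec n" "x \<noteq> 0\<^sub>v n" "complexify A *\<^sub>v x = l \<cdot>\<^sub>v x"
    unfolding spectrum_def eigenvalue_def eigenvector_def using A by auto
  define y where "y = vec n (\<lambda>i. norm (x $ i))"
  have y: "y \<in> carrier_vec n" "\<And>i. i < n \<Longrightarrow> 0 \<le> y $ i" unfolding y_def by auto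
  obtain i1 where i1: "i1 < n" "0 < y $ i1"
  proof -
    have "\<exists>i<n. x $ i \<noteq> 0" using x(1,2) by (auto intro!: eq_vecI)
    then show ?thesis using that unfolding y_def by auto
  qed
  define g where "g = A *\<^sub>v y - \<rho> \<cdot>\<^sub>v y"
  have g: "g \<in> carrier_vec n" unfolding g_def using A y by auto
  have g0: "0 \<le> g $ i" if i: "i < n" for i
  proof -
    have "\<rho> * y $ i = norm ((l \<cdot>\<^sub>v x) $ i)" using l x i unfolding y_def by (simp add: norm_mult)
    also have "\<dots> = norm (\<Sum>j<n. complexify A $$ (i, j) * x $ j)"
      unfolding x(3)[symmetric] mult_mat_vec_entry[OF cA x(1) i] ..
    also have "\<dots> \<le> (\<Sum>j<n. A $$ (i, j) * y $ j)"
      using A i unfolding y_def nonneg_mat_def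
      by (intro order_trans[OF norm_sum] sum_mono) (auto simp: norm_mult)
    also have "\<dots> = (A *\<^sub>v y) $ i" using mult_mat_vec_entry[OF A(1) y(1) i] by simp
    finally show ?thesis unfolding g_def using A y i by simp
  qed
  define v where "v = A ^\<^sub>m m *\<^sub>v y"
  have v: "v \<in> carrier_vec n" unfolding v_def using Am y(1) by (rule mult_mat_vec_carrier)
  have vpos: "0 < v $ i" if "i < n" for i
    unfolding v_def by (rule positive_mult_vec[OF Am m y i1 that])
  have Av: "A *\<^sub>v v = A ^\<^sub>m m *\<^sub>v (A *\<^sub>v y)"
  proof -
    have "A * A ^\<^sub>m m = A ^\<^sub>m m * A" using pow_mat_add[OF A(1), of 1 m] A by simp
    then show ?thesis unfolding v_def
      using assoc_mult_mat_vec[OF A(1) Am y(1)] assoc_mult_mat_vec[OF Am A(1) y(1)] by simp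
  qed
  have Ag: "A ^\<^sub>m m *\<^sub>v g = A *\<^sub>v v - \<rho> \<cdot>\<^sub>v v"
    unfolding Av g_def
    using mult_minus_distrib_mat_vec[OF Am, of "A *\<^sub>v y" "\<rho> \<cdot>\<^sub>v y"] mult_mat_vec[OF Am y(1)] A y
    unfolding v_def by simp
  have gz: "g $ i = 0" if i: "i < n" for i
  proof (rule ccontr)
    assume "g $ i \<noteq> 0"
    then have gi: "0 < g $ i" using g0[OF i] by simp
    \<comment> \<open>The largest \<open>t\<close> with \<open>A v \<ge> t v\<close>.\<close>
    define t where "t = Min ((\<lambda>j. (A *\<^sub>v v) $ j / v $ j) ` {..<n})"
    have "t \<in> (\<lambda>j. (A *\<^sub>v v) $ j / v $ j) ` {..<n}"
      unfolding t_def using n by (intro Min_in) auto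
    then obtain j where j: "j < n" "t = (A *\<^sub>v v) $ j / v $ j" by auto
    have "0 < (A ^\<^sub>m m *\<^sub>v g) $ j" by (rule positive_mult_vec[OF Am m g g0 i gi j(1)])
    then have "\<rho> * v $ j < (A *\<^sub>v v) $ j" unfolding Ag using v j A by simp
    then have t: "\<rho> < t" using vpos[OF j(1)] j by (simp add: pos_less_divide_eq)
    have "t * v $ k \<le> (A *\<^sub>v v) $ k" if k: "k < n" for k
    proof -
      have "t \<le> (A *\<^sub>v v) $ k / v $ k" unfolding t_def using k by (intro Min_le) auto
      then show ?thesis using vpos[OF k] by (simp add: field_simps)
    qed
    then have "t \<le> \<rho>" unfolding \<rho>_def
      using collatz_wielandt_le_spectral_radius[OF A v _ j(1) vpos[OF j(1)]] vpos less_imp_le by blast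
    with t show False by simp
  qed
  have "A *\<^sub>v y = \<rho> \<cdot>\<^sub>v y"
    using gz y A unfolding g_def by (intro eq_vecI) auto
  then have "A *\<^sub>v v = \<rho> \<cdot>\<^sub>v v"
    unfolding Av using mult_mat_vec[OF Am y(1)] by (simp add: v_def)
  then show ?thesis using v vpos unfolding pos_vec_def \<rho>_def by auto
qed

lemma spectral_radius_transpose:
  assumes "A \<in> carrier_mat n n"
  shows "spectral_radius (complexify (transpose_mat A)) = spectral_radius (complexify A)"
proof -
  have c: "complexify A \<in> carrier_mat n n" using assms by simp
  have e: "complexify (transpose_mat A) = transpose_mat (complexify A)"
    using assms by (intro eq_matI) auto
  have "spectrum (transpose_mat (complexify A)) = spectrum (complexify A)"
    using spectrum_root_char_poly[OF c] spectrum_root_char_poly[of "transpose_mat (complexify A)" n]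
      char_poly_transpose_mat[OF c] c by simp
  then show ?thesis unfolding spectral_radius_def e by simp
qed

section \<open>Convergence of normalised powers\<close>

text \<open>
  Here \<open>b\<close> is a positive matrix with \<open>b v = v\<close> and \<open>u\<^sup>T b = u\<^sup>T\<close>, and \<open>w k\<close> is \<open>b\<^sup>k\<close> applied to a
  vector orthogonal to \<open>u\<close>. By finiteness \<open>b \<ge> e v u\<^sup>T\<close> entrywise for some \<open>e > 0\<close>. Every \<open>w k\<close> is
  orthogonal to \<open>u\<close>, so \<open>b\<close> acts on it like the nonnegative matrix \<open>b - e v u\<^sup>T\<close>, which maps \<open>v\<close> to
  \<open>(1 - e) v\<close>. A bound \<open>\<bar>w k\<bar> \<le> c v\<close> therefore improves to \<open>\<bar>w (k + 1)\<bar> \<le> (1 - e) c v\<close>.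
\<close>

lemma rank_one_contraction:
  fixes b :: "nat \<Rightarrow> nat \<Rightarrow> real" and u v :: "nat \<Rightarrow> real" and w :: "nat \<Rightarrow> nat \<Rightarrow> real"
  assumes b: "\<And>i j. i < n \<Longrightarrow> j < n \<Longrightarrow> 0 < b i j"
    and v: "\<And>i. i < n \<Longrightarrow> 0 < v i" "\<And>i. i < n \<Longrightarrow> (\<Sum>j<n. b i j * v j) = v i"
    and u: "\<And>i. i < n \<Longrightarrow> 0 < u i" "\<And>j. j < n \<Longrightarrow> (\<Sum>i<n. u i * b i j) = u j"
    and uv: "(\<Sum>i<n. u i * v i) = 1"
    and w: "(\<Sum>i<n. u i * w 0 i) = 0"
      "\<And>k i. i < n \<Longrightarrow> w (Suc k) i = (\<Sum>j<n. b i j * w k j)"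
    and i: "i < n"
  shows "(\<lambda>k. w k i) \<longlonglongrightarrow> 0"
proof -
  define E where "E = (\<lambda>(i, j). b i j / (v i * u j)) ` ({..<n} \<times> {..<n})"
  have E: "finite E" "E \<noteq> {}" unfolding E_def using i by auto
  define e where "e = Min E"
  have e0: "0 < e" unfolding e_def using E b v u by (auto simp: E_def)
  have eb: "0 \<le> b i j - e * v i * u j" if "i < n" "j < n" for i j
  proof -
    have "e \<le> b i j / (v i * u j)" unfolding e_def using that E by (intro Min_le) (auto simp: E_def)
    then show ?thesis using v(1)[OF that(1)] u(1)[OF that(2)] by (simp add: field_simps)
  qed
  have sv: "(\<Sum>j<n. (b i j - e * v i * u j) * v j) = (1 - e) * v i" if "i < n" for i
  proof -
    have "(\<Sum>j<n. (b i j - e * v i * u j) * v j)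
      = (\<Sum>j<n. b i j * v j) - e * v i * (\<Sum>j<n. u j * v j)"
      by (simp add: left_diff_distrib sum_subtractf sum_distrib_left mult.assoc)
    then show ?thesis using v(2)[OF that] uv by (simp add: algebra_simps)
  qed
  have e1: "e \<le> 1"
  proof -
    have "0 \<le> (\<Sum>j<n. (b i j - e * v i * u j) * v j)"
      using eb[OF i] v(1) by (intro sum_nonneg) (simp add: less_imp_le)
    then show ?thesis using sv[OF i] v(1)[OF i] by (simp add: zero_le_mult_iff)
  qed
  have orth: "(\<Sum>i<n. u i * w k i) = 0" for k
  proof (induction k)
    case (Suc k)
    have "(\<Sum>i<n. u i * w (Suc k) i) = (\<Sum>i<n. \<Sum>j<n. u i * b i j * w k j)"
      by (simp add: w sum_distrib_left mult.assoc)
    also have "\<dots> = (\<Sum>j<n. (\<Sum>i<n. u i * b i j) * w k j)"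
      unfolding sum_distrib_right by (rule sum.swap)
    also have "\<dots> = 0" using Suc u(2) by simp
    finally show ?case .
  qed (rule w)
  define C where "C = (\<Sum>j<n. \<bar>w 0 j\<bar> / v j)"
  have bound: "\<bar>w k i\<bar> \<le> C * (1 - e) ^ k * v i" if "i < n" for k i
    using that
  proof (induction k arbitrary: i)
    case 0
    have "\<bar>w 0 i\<bar> / v i \<le> C" unfolding C_def
      using 0 v(1) by (intro member_le_sum) (auto simp: less_imp_le)
    then show ?case using v(1)[OF 0] by (simp add: field_simps)
  next
    case (Suc k)
    have "w (Suc k) i = (\<Sum>j<n. (b i j - e * v i * u j) * w k j)"
    proof -
      have "(\<Sum>j<n. (b i j - e * v i * u j) * w k j)
        = (\<Sum>j<n. b i j * w k j) - e * v i * (\<Sum>j<n. u j * w k j)"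
        by (simp add: left_diff_distrib sum_subtractf sum_distrib_left mult.assoc)
      then show ?thesis using orth w(2)[OF Suc.prems] by simp
    qed
    also have "\<bar>\<dots>\<bar> \<le> (\<Sum>j<n. (b i j - e * v i * u j) * (C * (1 - e) ^ k * v j))"
      using Suc eb by (intro order_trans[OF sum_abs] sum_mono) (auto simp: abs_mult intro!: mult_left_mono)
    also have "\<dots> = C * (1 - e) ^ k * (\<Sum>j<n. (b i j - e * v i * u j) * v j)"
      by (simp add: sum_distrib_left mult_ac)
    also have "\<dots> = C * (1 - e) ^ Suc k * v i" using sv[OF Suc.prems] by simp
    finally show ?case .
  qed
  have "(\<lambda>k. (1 - e) ^ k) \<longlonglongrightarrow> 0" using e0 e1 by (intro LIMSEQ_power_zero) simp
  then have lim: "(\<lambda>k. C * (1 - e) ^ k * v i) \<longlonglongrightarrow> 0"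
    by (intro tendsto_mult_left_zero tendsto_mult_right_zero)
  have "(\<lambda>k. \<bar>w k i\<bar>) \<longlonglongrightarrow> 0"
    by (rule tendsto_sandwich[OF _ _ tendsto_const lim]) (use bound i in simp_all)
  then show ?thesis by (rule tendsto_rabs_zero_cancel)
qed

text \<open>
  Column \<open>j\<close> of \<open>A\<^bsup>mk\<^esup> / r\<^bsup>mk\<^esup>\<close> minus \<open>u\<^sub>j v\<close> is a vector orthogonal to \<open>u\<close>, because \<open>u \<bullet> v = 1\<close>,
  and passing from \<open>k\<close> to \<open>k + 1\<close> multiplies it by \<open>A\<^sup>m / r\<^sup>m\<close>. So it tends to \<open>0\<close>. Only the
  powers with exponents \<open>m k\<close> are treated; this subsequence is enough for comparing limits.
\<close>

lemma primitive_power_tendsto_rank_one: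
  fixes r :: real
  assumes A: "A \<in> carrier_mat n n"
    and m: "\<And>i j. i < n \<Longrightarrow> j < n \<Longrightarrow> 0 < (A ^\<^sub>m m) $$ (i, j)"
    and v: "v \<in> carrier_vec n" "pos_vec v" "A *\<^sub>v v = r \<cdot>\<^sub>v v"
    and u: "u \<in> carrier_vec n" "pos_vec u" "transpose_mat A *\<^sub>v u = r \<cdot>\<^sub>v u"
    and uv: "u \<bullet> v = 1" and r: "0 < r"
    and ij: "i < n" "j < n"
  shows "(\<lambda>k. (A ^\<^sub>m (m * k)) $$ (i, j) / r ^ (m * k)) \<longlonglongrightarrow> v $ i * u $ j"
proof -
  have Ak: "A ^\<^sub>m k \<in> carrier_mat n n" for k using A by simp
  have powv: "(\<Sum>l<n. (A ^\<^sub>m k) $$ (x, l) * v $ l) = r ^ k * v $ x" if "x < n" for k x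
  proof -
    have "eigenvector A v r"
      using v ij A unfolding eigenvector_def pos_vec_def by auto
    then have "A ^\<^sub>m k *\<^sub>v v = r ^ k \<cdot>\<^sub>v v" by (rule eigenvector_pow[OF A])
    then show ?thesis using mult_mat_vec_entry[OF Ak v(1) that, of k] that v by simp
  qed
  have powu: "(\<Sum>l<n. u $ l * (A ^\<^sub>m k) $$ (l, x)) = r ^ k * u $ x" if "x < n" for k x
  proof -
    have At: "transpose_mat A \<in> carrier_mat n n" using A by simp
    have "eigenvector (transpose_mat A) u r"
      using u ij A unfolding eigenvector_def pos_vec_def by auto
    then have "transpose_mat A ^\<^sub>m k *\<^sub>v u = r ^ k \<cdot>\<^sub>v u" by (rule eigenvector_pow[OF At])
    then have "transpose_mat (A ^\<^sub>m k) *\<^sub>v u = r ^ k \<cdot>\<^sub>v u" unfolding transpose_pow_mat[OF A] .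
    then show ?thesis
      using mult_mat_vec_entry[of "transpose_mat (A ^\<^sub>m k)" n u x] that u A Ak[of k] by (simp add: mult.commute)
  qed
  have uvs: "(\<Sum>l<n. u $ l * v $ l) = 1"
    using uv u v by (simp add: scalar_prod_def lessThan_atLeast0)
  define b where "b x y = (A ^\<^sub>m m) $$ (x, y) / r ^ m" for x y
  define w where "w k x = (A ^\<^sub>m (m * k)) $$ (x, j) / r ^ (m * k) - v $ x * u $ j" for k x
  have "(\<lambda>k. w k i) \<longlonglongrightarrow> 0"
  proof (rule rank_one_contraction[of n b "($) v" "($) u"])
    show "0 < b x y" if "x < n" "y < n" for x y using m[OF that] r unfolding b_def by simp
    show bv: "(\<Sum>y<n. b x y * v $ y) = v $ x" if "x < n" for x
      using powv[OF that, of m] r unfolding b_def by (simp flip: sum_divide_distrib)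
    show "(\<Sum>x<n. u $ x * b x y) = u $ y" if "y < n" for y
      using powu[OF that, of m] r unfolding b_def by (simp flip: sum_divide_distrib)
    show "(\<Sum>x<n. u $ x * w 0 x) = 0"
    proof -
      have "(\<Sum>x<n. u $ x * w 0 x) = (\<Sum>x<n. u $ x * (A ^\<^sub>m 0) $$ (x, j)) - (\<Sum>x<n. u $ x * v $ x) * u $ j"
        unfolding w_def sum_distrib_right sum_subtractf[symmetric]
        by (intro sum.cong) (simp_all add: algebra_simps)
      then show ?thesis using powu[OF ij(2), of 0] uvs by simp
    qed
    show "w (Suc k) x = (\<Sum>y<n. b x y * w k y)" if x: "x < n" for k x
    proof -
      have "(A ^\<^sub>m (m * Suc k)) $$ (x, j) = (\<Sum>y<n. (A ^\<^sub>m m) $$ (x, y) * (A ^\<^sub>m (m * k)) $$ (y, j))"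
        using pow_mat_add[OF A, of m "m * k"] mult_mat_entry[OF Ak Ak x ij(2)] by simp
      then have "(A ^\<^sub>m (m * Suc k)) $$ (x, j) / r ^ (m * Suc k)
        = (\<Sum>y<n. b x y * ((A ^\<^sub>m (m * k)) $$ (y, j) / r ^ (m * k)))"
        unfolding b_def by (simp add: power_add sum_divide_distrib)
      moreover have "v $ x * u $ j = (\<Sum>y<n. b x y * (v $ y * u $ j))"
        using bv[OF x] by (simp add: mult.assoc[symmetric] flip: sum_distrib_right)
      ultimately show ?thesis unfolding w_def by (simp add: right_diff_distrib sum_subtractf)
    qed
  qed (use u v uvs ij in \<open>auto simp: pos_vec_def\<close>)
  then show ?thesis unfolding w_def by (rule LIM_zero_cancel)
qed

lemma pos_vec_scalar_prod_pos:
  assumes "u \<in> carrier_vec n" "v \<in> carrier_vec n" "pos_vec u" "pos_vec v" "0 < n"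
  shows "0 < u \<bullet> v"
  using assms unfolding scalar_prod_def pos_vec_def by (intro sum_pos) auto

lemma pos_vec_smult:
  assumes "pos_vec v" "0 < c"
  shows "pos_vec (c \<cdot>\<^sub>v v)"
  using assms unfolding pos_vec_def by simp

section \<open>The Perron-Frobenius vectors\<close>

text \<open>
  Uniqueness comes from uniqueness of limits: for two pairs \<open>(u, v)\<close> and \<open>(u', v')\<close> of positive
  eigenvectors with \<open>u \<bullet> v = u' \<bullet> v' = 1\<close> the matrices \<open>v u\<^sup>T\<close> and \<open>v' u'\<^sup>T\<close> are limits of the same
  sequence. For right eigenvectors, both partners are taken to be multiples of one left eigenvector;
  then \<open>v\<close> and \<open>v'\<close> are proportional, and equal if of the same norm.
\<close>

lemma pf_vectors:
  assumes A: "A \<in> carrier_mat n n" "nonneg_mat A" "primitive_mat A" and n: "0 < n"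
  defines "\<rho> \<equiv> spectral_radius (complexify A)"
  shows "0 < \<rho>"
    and "right_pf A \<in> carrier_vec n \<and> pos_vec (right_pf A) \<and>
      A *\<^sub>v right_pf A = \<rho> \<cdot>\<^sub>v right_pf A \<and> right_pf A \<bullet> right_pf A = 1"
    and "left_pf A \<in> carrier_vec n \<and> pos_vec (left_pf A) \<and>
      transpose_mat A *\<^sub>v left_pf A = \<rho> \<cdot>\<^sub>v left_pf A \<and> left_pf A \<bullet> right_pf A = 1"
proof -
  obtain m where m0: "0 < m" and m: "\<And>i j. i < n \<Longrightarrow> j < n \<Longrightarrow> 0 < (A ^\<^sub>m m) $$ (i, j)"
    using A unfolding primitive_mat_def by auto
  have At: "transpose_mat A \<in> carrier_mat n n" "nonneg_mat (transpose_mat A)"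
    using A unfolding nonneg_mat_def by auto
  have Am: "A ^\<^sub>m m \<in> carrier_mat n n" using A by simp
  have mt: "0 < (transpose_mat A ^\<^sub>m m) $$ (i, j)" if "i < n" "j < n" for i j
    unfolding transpose_pow_mat[OF A(1)] using m that carrier_matD[OF Am] by simp
  define R where "R v \<longleftrightarrow> v \<in> carrier_vec n \<and> pos_vec v \<and> A *\<^sub>v v = \<rho> \<cdot>\<^sub>v v" for v
  define L where "L u \<longleftrightarrow> u \<in> carrier_vec n \<and> pos_vec u \<and> transpose_mat A *\<^sub>v u = \<rho> \<cdot>\<^sub>v u" for u
  obtain v0 where v0: "R v0"
    using perron_vector_exists[OF A(1,2) n m] unfolding R_def \<rho>_def by blast
  obtain u0 where u0: "L u0"
    using perron_vector_exists[OF At n mt] unfolding L_def \<rho>_def spectral_radius_transpose[OF A(1)] by blast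
  \<comment> \<open>Positivity of \<open>\<rho>\<close> uses \<open>m > 0\<close>: if \<open>\<rho> = 0\<close>, then \<open>A\<^sup>m v0 = 0\<close>, but \<open>A\<^sup>m\<close> and \<open>v0\<close> are positive.\<close>
  show \<rho>: "0 < \<rho>"
  proof -
    have v0': "v0 \<in> carrier_vec n" "pos_vec v0" "A *\<^sub>v v0 = \<rho> \<cdot>\<^sub>v v0" using v0 unfolding R_def by auto
    have "eigenvector A v0 \<rho>"
      using v0' n A unfolding eigenvector_def pos_vec_def by auto
    then have "A ^\<^sub>m m *\<^sub>v v0 = \<rho> ^ m \<cdot>\<^sub>v v0" by (rule eigenvector_pow[OF A(1)])
    moreover have "0 < (A ^\<^sub>m m *\<^sub>v v0) $ 0"
      using positive_mult_vec[OF Am m v0'(1) _ n _ n] v0' n unfolding pos_vec_def by (auto simp: less_imp_le)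
    ultimately have "\<rho> \<noteq> 0" using v0' n m0 by (auto simp: power_0_left)
    moreover have "0 \<le> \<rho>"
      using spectral_radius_mem_max(1)[of "complexify A" n] A n unfolding \<rho>_def by auto
    ultimately show ?thesis by simp
  qed
  have Rs: "R (c \<cdot>\<^sub>v v)" if "R v" "0 < c" for c v
    using that A(1) mult_mat_vec[OF A(1), of v c] unfolding R_def
    by (auto simp: pos_vec_smult smult_smult_assoc mult.commute)
  have Ls: "L (c \<cdot>\<^sub>v v)" if "L v" "0 < c" for c v
    using that At(1) mult_mat_vec[OF At(1), of v c] unfolding L_def
    by (auto simp: pos_vec_smult smult_smult_assoc mult.commute)
  have uniq: "v $ i * u $ j = v' $ i * u' $ j"
    if "R v" "L u" "u \<bullet> v = 1" "R v'" "L u'" "u' \<bullet> v' = 1" "i < n" "j < n" for u v u' v' i j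
    using primitive_power_tendsto_rank_one[OF A(1) m, of v \<rho> u i j]
      primitive_power_tendsto_rank_one[OF A(1) m, of v' \<rho> u' i j] \<rho> that
    unfolding R_def L_def by (intro LIMSEQ_unique) auto
  have norm_u: "\<exists>c>0. (c \<cdot>\<^sub>v u0) \<bullet> v = 1" if "R v" for v
  proof -
    have "0 < u0 \<bullet> v" using pos_vec_scalar_prod_pos[of u0 n v] u0 that n unfolding R_def L_def by blast
    then show ?thesis
      using u0 that unfolding R_def L_def by (intro exI[of _ "1 / (u0 \<bullet> v)"]) auto
  qed
  have ex_right: "\<exists>!v. R v \<and> v \<bullet> v = 1"
  proof -
    define c where "c = 1 / sqrt (v0 \<bullet> v0)"
    have vv: "0 < v0 \<bullet> v0" using pos_vec_scalar_prod_pos[of v0 n v0] v0 n unfolding R_def by blast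
    then have c: "0 < c" "c * c * (v0 \<bullet> v0) = 1" unfolding c_def by auto
    have "(c \<cdot>\<^sub>v v0) \<bullet> (c \<cdot>\<^sub>v v0) = 1" using v0 c unfolding R_def by (auto simp: mult.assoc)
    then have "R (c \<cdot>\<^sub>v v0) \<and> (c \<cdot>\<^sub>v v0) \<bullet> (c \<cdot>\<^sub>v v0) = 1" using Rs[OF v0 c(1)] by simp
    moreover have "v = v'" if v: "R v" "v \<bullet> v = 1" and v': "R v'" "v' \<bullet> v' = 1" for v v'
    proof -
      have car: "v \<in> carrier_vec n" "v' \<in> carrier_vec n" using v v' unfolding R_def by auto
      obtain a b where a: "0 < a" "(a \<cdot>\<^sub>v u0) \<bullet> v = 1" and b: "0 < b" "(b \<cdot>\<^sub>v u0) \<bullet> v' = 1"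
        using norm_u v v' by meson
      define d where "d = b / a"
      have d: "0 < d" using a b unfolding d_def by simp
      have "v $ i = d * v' $ i" if i: "i < n" for i
      proof -
        have "v $ i * (a \<cdot>\<^sub>v u0) $ 0 = v' $ i * (b \<cdot>\<^sub>v u0) $ 0"
          using uniq[OF v(1) Ls[OF u0 a(1)] a(2) v'(1) Ls[OF u0 b(1)] b(2) i n] .
        then show ?thesis
          using u0 n a unfolding L_def pos_vec_def d_def by (auto simp: field_simps)
      qed
      then have veq: "v = d \<cdot>\<^sub>v v'" using car by (intro eq_vecI) auto
      have "d * d * (v' \<bullet> v') = 1" using v(2) car unfolding veq by (simp add: mult.assoc)
      then have "d = 1" using v' d by (simp add: square_eq_1_iff)
      then show ?thesis using veq by simp
    qed
    ultimately show ?thesis by blast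
  qed
  have right_eq: "right_pf A = (THE v. R v \<and> v \<bullet> v = 1)"
    using A unfolding right_pf_def R_def \<rho>_def by (simp add: conj_assoc)
  have r: "R (right_pf A)" "right_pf A \<bullet> right_pf A = 1"
    using theI'[OF ex_right] unfolding right_eq by auto
  then show "right_pf A \<in> carrier_vec n \<and> pos_vec (right_pf A) \<and>
      A *\<^sub>v right_pf A = \<rho> \<cdot>\<^sub>v right_pf A \<and> right_pf A \<bullet> right_pf A = 1"
    unfolding R_def by simp
  have ex_left: "\<exists>!u. L u \<and> u \<bullet> right_pf A = 1"
  proof -
    obtain a where "0 < a" "(a \<cdot>\<^sub>v u0) \<bullet> right_pf A = 1" using norm_u r by meson
    then have "L (a \<cdot>\<^sub>v u0) \<and> (a \<cdot>\<^sub>v u0) \<bullet> right_pf A = 1" using Ls[OF u0] by simp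
    moreover have "u = u'"
      if u: "L u" "u \<bullet> right_pf A = 1" and u': "L u'" "u' \<bullet> right_pf A = 1" for u u'
    proof -
      have "u $ j = u' $ j" if "j < n" for j
        using uniq[OF r(1) u r(1) u' n that] r(1) n unfolding R_def pos_vec_def by auto
      then show ?thesis using u u' unfolding L_def by (intro eq_vecI) auto
    qed
    ultimately show ?thesis by blast
  qed
  have "left_pf A = (THE u. L u \<and> u \<bullet> right_pf A = 1)"
    using A unfolding left_pf_def L_def \<rho>_def by (simp add: conj_assoc)
  then have "L (left_pf A)" "left_pf A \<bullet> right_pf A = 1"
    using theI'[OF ex_left] by auto
  then show "left_pf A \<in> carrier_vec n \<and> pos_vec (left_pf A) \<and>
      transpose_mat A *\<^sub>v left_pf A = \<rho> \<cdot>\<^sub>v left_pf A \<and> left_pf A \<bullet> right_pf A = 1"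
    unfolding L_def by simp
qed

section \<open>Communicability and control schedules\<close>

lemma communicability_eq_sum:
  assumes "A \<in> carrier_mat n n" "i < n"
  shows "communicability A k i = (\<Sum>l<n. ((A ^\<^sub>m k) $$ (l, i))\<^sup>2)"
proof -
  have "A ^\<^sub>m k \<in> carrier_mat n n" using assms by simp
  then show ?thesis unfolding communicability_def using assms
    by (subst mult_mat_entry[of _ n]) (auto simp: power2_eq_square)
qed

text \<open>
  \<open>R\<^sub>i(k)\<close> is the squared norm of column \<open>i\<close> of \<open>A\<^sup>k\<close>, and the normalised column tends to \<open>u\<^sub>i v\<close>
  with \<open>v\<close> of norm \<open>1\<close>.
\<close>

lemma communicability_tendsto:
  assumes A: "A \<in> carrier_mat n n" "nonneg_mat A" "primitive_mat A" and n: "0 < n"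
  shows "\<exists>m>0. \<forall>i<n. (\<lambda>k. communicability A (m * k) i / (spectral_radius (complexify A) ^ (m * k))\<^sup>2)
    \<longlonglongrightarrow> communicability_inf A i"
proof -
  obtain m where m0: "0 < m" and m: "\<And>i j. i < n \<Longrightarrow> j < n \<Longrightarrow> 0 < (A ^\<^sub>m m) $$ (i, j)"
    using A unfolding primitive_mat_def by auto
  define \<rho> where "\<rho> = spectral_radius (complexify A)"
  define u v where "u = left_pf A" and "v = right_pf A"
  note pf = pf_vectors[OF A n, folded \<rho>_def u_def v_def]
  have "(\<lambda>k. communicability A (m * k) i / (\<rho> ^ (m * k))\<^sup>2) \<longlonglongrightarrow> (u $ i)\<^sup>2" if i: "i < n" for i
  proof -
    have "(\<lambda>k. \<Sum>l<n. ((A ^\<^sub>m (m * k)) $$ (l, i) / \<rho> ^ (m * k))\<^sup>2) \<longlonglongrightarrow> (\<Sum>l<n. (v $ l * u $ i)\<^sup>2)"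
      using pf i by (intro tendsto_sum tendsto_power primitive_power_tendsto_rank_one[OF A(1) m]) auto
    moreover have "(\<Sum>l<n. (v $ l * u $ i)\<^sup>2) = (v \<bullet> v) * (u $ i)\<^sup>2"
      using pf unfolding power_mult_distrib sum_distrib_right[symmetric]
      by (auto simp: scalar_prod_def lessThan_atLeast0 power2_eq_square)
    ultimately show ?thesis
      using pf communicability_eq_sum[OF A(1) i] by (simp add: power_divide sum_divide_distrib)
  qed
  then show ?thesis using m0 unfolding communicability_inf_def \<rho>_def u_def by blast
qed

text \<open>
  The summand for \<open>k\<close> is \<open>c c\<^sup>T\<close> with \<open>c\<close> the column of \<open>A\<^sup>k\<close> that the schedule selects, and its trace
  is the squared norm of \<open>c\<close>.
\<close>

lemma trace_gramian:
  assumes A: "A \<in> carrier_mat n n" and \<iota>: "\<iota> \<in> schedules A K"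
  shows "mat_trace (gramian A K \<iota>) = (\<Sum>k<K. communicability A k (\<iota> (K - 1 - k)))"
proof -
  have entry: "(A ^\<^sub>m k * input_col n s * transpose_mat (input_col n s) * (transpose_mat A) ^\<^sub>m k) $$ (i, i)
      = ((A ^\<^sub>m k) $$ (i, s))\<^sup>2" if "i < n" "s < n" for k i s
  proof -
    have Ak: "A ^\<^sub>m k \<in> carrier_mat n n" using A by simp
    have b: "input_col n s \<in> carrier_mat n 1" unfolding input_col_def by auto
    define c where "c = A ^\<^sub>m k * input_col n s"
    have c: "c \<in> carrier_mat n 1" unfolding c_def using Ak b by simp
    have "c * transpose_mat (input_col n s) * (transpose_mat A) ^\<^sub>m k = c * transpose_mat c"
      unfolding transpose_pow_mat[OF A] c_def transpose_mult[OF Ak b]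
      using assoc_mult_mat[OF _ _ transpose_carrier_mat[THEN iffD2, OF Ak], of c n 1 "transpose_mat (input_col n s)"] c b
      unfolding c_def by simp
    moreover have "c $$ (i, 0) = (A ^\<^sub>m k) $$ (i, s)"
      unfolding c_def using that A Ak by (auto simp: input_col_def mat_of_cols_def scalar_prod_def if_distrib[of "(*) _"] cong: if_cong)
    ultimately show ?thesis
      using c that unfolding c_def[symmetric] by (auto simp: scalar_prod_def power2_eq_square)
  qed
  have mem: "\<iota> (K - 1 - k) < n" if "k < K" for k
    using \<iota> A that PiE_mem[of \<iota> "{..<K}" "\<lambda>_. nodes A" "K - 1 - k"] unfolding schedules_def nodes_def by auto
  have "mat_trace (gramian A K \<iota>) = (\<Sum>i<n. \<Sum>k<K. ((A ^\<^sub>m k) $$ (i, \<iota> (K - 1 - k)))\<^sup>2)"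
    unfolding mat_trace_def gramian_def Let_def using A mem entry by (auto intro!: sum.cong)
  also have "\<dots> = (\<Sum>k<K. \<Sum>i<n. ((A ^\<^sub>m k) $$ (i, \<iota> (K - 1 - k)))\<^sup>2)" by (rule sum.swap)
  also have "\<dots> = (\<Sum>k<K. communicability A k (\<iota> (K - 1 - k)))"
    using communicability_eq_sum[OF A mem] by (auto intro!: sum.cong)
  finally show ?thesis .
qed

text \<open>
  Changing an optimal constant schedule at the single time \<open>K - 1 - k\<close> to a better node for this
  \<open>k\<close> affects one summand of the trace only and increases it. The denominator of \<open>\<chi>\<close> is positive
  since \<open>R\<^sub>i(0) = 1\<close>.
\<close>

lemma class_V_if_no_constant_optimum:
  assumes A: "A \<in> carrier_mat n n" and n: "0 < n" and K: "0 < K"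
    and beaten: "\<And>i. i < n \<Longrightarrow> \<exists>k<K. \<exists>j<n. communicability A k i < communicability A k j"
  shows "class_V A K"
proof -
  define F where "F \<iota> = mat_trace (gramian A K \<iota>)" for \<iota>
  define const where "const i = (\<lambda>k\<in>{..<K}. i)" for i :: nat
  have nodes: "nodes A = {..<n}" using A unfolding nodes_def by simp
  have fin: "finite (schedules A K)"
    unfolding schedules_def nodes by (intro finite_PiE) auto
  have sub: "constant_schedules A K \<subseteq> schedules A K" unfolding constant_schedules_def by auto
  have const: "const i \<in> constant_schedules A K" if "i < n" for i
    using that unfolding constant_schedules_def schedules_def nodes const_def by auto
  have TV: "F \<iota> \<le> f_max_TV A K" if "\<iota> \<in> schedules A K" for \<iota>
    using that fin unfolding f_max_TV_def F_def by (intro Max_ge) auto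
  have TI: "F \<iota> \<le> f_max_TI A K" if "\<iota> \<in> constant_schedules A K" for \<iota>
    using that finite_subset[OF sub fin] unfolding f_max_TI_def F_def by (intro Max_ge) auto
  have "f_max_TI A K \<in> F ` constant_schedules A K"
    unfolding f_max_TI_def F_def using finite_subset[OF sub fin] const[OF n] by (intro Max_in) auto
  then obtain \<iota> i where \<iota>: "\<iota> \<in> schedules A K" "f_max_TI A K = F \<iota>"
    and i: "i < n" "\<And>k. k < K \<Longrightarrow> \<iota> k = i"
    unfolding constant_schedules_def nodes by auto
  obtain k0 j where k0: "k0 < K" and j: "j < n" and lt: "communicability A k0 i < communicability A k0 j"
    using beaten[OF i(1)] by blast
  define \<kappa> where "\<kappa> = \<iota>(K - 1 - k0 := j)"
  have \<kappa>: "\<kappa> \<in> schedules A K"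
    using \<iota>(1) j k0 unfolding schedules_def nodes \<kappa>_def by (auto simp: PiE_iff extensional_def)
  have "F \<iota> < F \<kappa>"
    unfolding F_def trace_gramian[OF A \<iota>(1)] trace_gramian[OF A \<kappa>]
  proof (rule sum_strict_mono_ex1)
    show "\<forall>k\<in>{..<K}. communicability A k (\<iota> (K - 1 - k)) \<le> communicability A k (\<kappa> (K - 1 - k))"
    proof
      fix k assume "k \<in> {..<K}"
      then have "K - 1 - k = K - 1 - k0 \<longleftrightarrow> k = k0" using k0 by auto
      then show "communicability A k (\<iota> (K - 1 - k)) \<le> communicability A k (\<kappa> (K - 1 - k))"
        using lt i(2)[of "K - 1 - k0"] k0 unfolding \<kappa>_def by auto
    qed
    show "\<exists>k\<in>{..<K}. communicability A k (\<iota> (K - 1 - k)) < communicability A k (\<kappa> (K - 1 - k))"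
      using lt i(2)[of "K - 1 - k0"] k0 unfolding \<kappa>_def by (intro bexI[of _ k0]) auto
  qed simp
  then have gt: "f_max_TI A K < f_max_TV A K" using TV[OF \<kappa>] \<iota> by simp
  have "0 < f_max_TI A K"
  proof -
    have s: "const 0 \<in> schedules A K" using const[OF n] sub by blast
    have "communicability A 0 0 = (\<Sum>l<n. if l = 0 then 1 else 0)"
      unfolding communicability_eq_sum[OF A n] using A n by (intro sum.cong) auto
    then have one: "communicability A 0 0 = 1" using n by simp
    have "0 < F (const 0)"
      unfolding F_def trace_gramian[OF A s]
    proof (rule sum_pos2[of _ 0])
      show "0 \<le> communicability A k (const 0 (K - 1 - k))" if "k \<in> {..<K}" for k
        using that communicability_eq_sum[OF A n] unfolding const_def by (simp add: sum_nonneg)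
    qed (use K one in \<open>auto simp: const_def\<close>)
    then show ?thesis using TI[OF const[OF n]] by simp
  qed
  then show ?thesis unfolding class_V_def chi_def using gt by simp
qed

theorem theorem4p3:
  fixes A :: "real mat" and n :: nat
  assumes "A \<in> carrier_mat n n"
    and "nonneg_mat A"
    and "irreducible_mat A"
    and "aperiodic_mat A"
    and "diagonalizable_mat A"
    and "argmax_nodes A (communicability A 1) \<inter> argmax_nodes A (communicability_inf A) = {}"
  shows "\<exists>Kbar::nat. \<forall>K > Kbar. class_V A K"
proof -
  note A = assms(1)
  have nodes: "nodes A = {..<n}" using A unfolding nodes_def by simp
  \<comment> \<open>A network without nodes has no cycle, so every \<open>d\<close> divides all cycle lengths.\<close>
  have n: "0 < n"
  proof (rule ccontr)
    assume "\<not> 0 < n"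
    then have "arcs (with_proj (network A)) = {}" unfolding network_def nodes by auto
    then have "\<not> pre_digraph.cycle (with_proj (network A)) c" for c
      by (auto simp: pre_digraph.cycle_def pre_digraph.awalk_def)
    then show False using assms(4) unfolding aperiodic_mat_def by (auto dest!: spec[of _ 2])
  qed
  have prim: "primitive_mat A"
    by (rule irreducible_aperiodic_imp_primitive[OF assms(1-4)])
  have beaten: "\<exists>k. \<exists>j<n. communicability A k i < communicability A k j" if i: "i < n" for i
  proof (cases "i \<in> argmax_nodes A (communicability A 1)")
    case False
    then show ?thesis using i unfolding argmax_nodes_def is_arg_max_def nodes by auto
  next
    case True
    then have "i \<notin> argmax_nodes A (communicability_inf A)" using assms(6) by blast
    then obtain j where j: "j < n" "communicability_inf A i < communicability_inf A j"
      using i unfolding argmax_nodes_def is_arg_max_def nodes by auto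
    define s where "s = spectral_radius (complexify A)"
    obtain m where m: "\<And>i. i < n \<Longrightarrow>
        (\<lambda>k. communicability A (m * k) i / (s ^ (m * k))\<^sup>2) \<longlonglongrightarrow> communicability_inf A i"
      using communicability_tendsto[OF A assms(2) prim n] unfolding s_def by blast
    obtain c where c: "communicability_inf A i < c" "c < communicability_inf A j"
      using dense[OF j(2)] by blast
    have "eventually (\<lambda>k. communicability A (m * k) i / (s ^ (m * k))\<^sup>2
        < communicability A (m * k) j / (s ^ (m * k))\<^sup>2) sequentially"
      using order_tendstoD(2)[OF m[OF i] c(1)] order_tendstoD(1)[OF m[OF j(1)] c(2)]
      by eventually_elim simp
    then obtain k where "communicability A (m * k) i / (s ^ (m * k))\<^sup>2
        < communicability A (m * k) j / (s ^ (m * k))\<^sup>2"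
      unfolding eventually_sequentially by blast
    moreover have "0 < s" using pf_vectors(1)[OF A assms(2) prim n] unfolding s_def .
    ultimately show ?thesis using j by (auto simp: divide_less_cancel)
  qed
  have "\<forall>i. \<exists>k. i < n \<longrightarrow> (\<exists>j<n. communicability A k i < communicability A k j)" using beaten by blast
  then obtain k where k: "\<And>i. i < n \<Longrightarrow> \<exists>j<n. communicability A (k i) i < communicability A (k i) j"
    unfolding choice_iff by blast
  define Kbar where "Kbar = Max (k ` {..<n})"
  have "class_V A K" if K: "K > Kbar" for K
  proof (rule class_V_if_no_constant_optimum[OF A n])
    fix i assume i: "i < n"
    then have "k i \<le> Kbar" unfolding Kbar_def by (intro Max_ge) auto
    then show "\<exists>k<K. \<exists>j<n. communicability A k i < communicability A k j"
      using k[OF i] K by (intro exI[of _ "k i"]) auto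
  qed (use K in simp)
  then show ?thesis by blast
qed

end
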